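(* For $n\ge 15$, the number of subsets $S\subseteq\{0,1,\dots,n-1\}$ with $|S+S|>|S-S|$ is at least $(2\times10^{-7})\,2^n$.
   Context: $S+S=\{s_1+s_2: s_1,s_2\in S\}$ and $S-S=\{s_1-s_2: s_1,s_2\in S\}$. *)

theory Defs
  imports Complex_Main "HOL-Library.Set_Algebras"
begin

(* On sets, + is the elementwise sum of Set_Algebras, but - is set-theoretic difference,
   so the elementwise difference set needs its own constant. *)
definition diffset :: "int set \<Rightarrow> int set \<Rightarrow> int set" where
  "diffset A B = {a - b | a b. a \<in> A \<and> b \<in> B}"

end

theory Submission
  imports Defs
begin

text \<open>
  Prescribe the 11 lowest and the 11 highest elements of \<open>[0, n - 1]\<close> so that no difference equals
  \<open>n - 7\<close>, while the prescribed elements alone produce all sums in \<open>[0, 20]\<close> except \<open>1\<close>, all sums in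
  \<open>[n - 11, n + 9]\<close> and all sums in \<open>[2n - 22, 2n - 2]\<close>. Then a set \<open>S\<close> has at most \<open>2n - 3\<close>
  differences, and at least \<open>2n - 2\<close> sums as soon as no further sum is missing. A remaining sum \<open>k\<close> is missed
  with probability at most \<open>2^(-7) (3/4)^j\<close> (below \<open>n\<close>) or \<open>2^(-8) (3/4)^j\<close> (above \<open>n\<close>), where \<open>j\<close> is
  the number of disjoint pairs of middle elements summing to \<open>k\<close> and the powers of two come from the
  7 lower, respectively 8 upper, prescribed elements. A union bound leaves a fraction \<open>29/32\<close> of the \<open>2^(n - 22)\<close> middle
  parts, and \<open>29/32 * 2^(-22) > 2 * 10^(-7)\<close>. For \<open>n < 22\<close> the bound is below 1, and Conway's
  set suffices.
\<close>

section \<open>Counting sets that avoid prescribed points and pairs\<close>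

text \<open>Each point of \<open>F\<close> halves the count. Each pair leaves three of its four
  possible traces, and since the pairs are disjoint from one another and from \<open>F\<close>,
  these factors multiply.\<close>

lemma card_subsets_avoiding_pairs_le:
  fixes V F :: "'a set" and x y :: "nat \<Rightarrow> 'a"
  assumes "finite V" "F \<subseteq> V"
    and "\<And>t. t < j \<Longrightarrow> x t \<in> V - F" "\<And>t. t < j \<Longrightarrow> y t \<in> V - F"
    and "inj_on x {..<j}" "inj_on y {..<j}"
    and "\<And>s t. s < j \<Longrightarrow> t < j \<Longrightarrow> x s \<noteq> y t"
  shows "real (card {S. S \<subseteq> V \<and> S \<inter> F = {} \<and> (\<forall>t<j. \<not> (x t \<in> S \<and> y t \<in> S))})
           \<le> 2 ^ card V * (1/2) ^ card F * (3/4) ^ j"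
  using assms
proof (induction j arbitrary: V)
  case 0
  have "{S. S \<subseteq> V \<and> S \<inter> F = {}} = Pow (V - F)"
    by auto
  moreover have "real (card (Pow (V - F))) = 2 ^ (card V - card F)"
    using 0 by (simp add: card_Pow card_Diff_subset finite_subset)
  moreover have "(2::real) ^ (card V - card F) = 2 ^ card V * (1/2) ^ card F"
    using 0 by (simp add: power_diff card_mono power_one_over)
  ultimately show ?case
    by simp
next
  case (Suc j)
  define W where "W = V - {x j, y j}"
  define G where "G = {S. S \<subseteq> W \<and> S \<inter> F = {} \<and> (\<forall>t<j. \<not> (x t \<in> S \<and> y t \<in> S))}"
  have "finite W"
    using Suc.prems(1) by (simp add: W_def)
  then have fG: "finite G"
    by (auto simp: G_def)
  have xne: "x t \<noteq> x j" and yne: "y t \<noteq> y j" if "t < j" for t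
    using that Suc.prems(5,6) by (auto simp: inj_on_def)
  have xy: "x j \<noteq> y j" "x j \<in> V - F" "y j \<in> V - F"
    using Suc.prems by auto
  have IH: "real (card G) \<le> 2 ^ card W * (1/2) ^ card F * (3/4) ^ j"
    unfolding G_def
  proof (rule Suc.IH)
    show "F \<subseteq> W"
      using Suc.prems(2) xy by (auto simp: W_def)
    show "x t \<in> W - F" if "t < j" for t
      using that Suc.prems(3)[of t] Suc.prems(7)[of t j] xne[of t] by (auto simp: W_def)
    show "y t \<in> W - F" if "t < j" for t
      using that Suc.prems(4)[of t] Suc.prems(7)[of j t] yne[of t] by (auto simp: W_def)
    show "inj_on x {..<j}" "inj_on y {..<j}"
      using Suc.prems(5,6) by (auto simp: inj_on_def)
    show "x s \<noteq> y t" if "s < j" "t < j" for s t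
      using that Suc.prems(7) by simp
  qed fact
  have cV: "card V = card W + 2"
    using xy Suc.prems(1) card_Diff_subset[of "{x j, y j}" V] card_mono[of V "{x j, y j}"]
    by (auto simp: W_def)
  \<comment> \<open>Split by the trace of \<open>S\<close> on \<open>{x j, y j}\<close>: the full
    trace is excluded, and each of the other three yields at most a copy of \<open>G\<close>. As
    \<open>V\<close> has two points more than \<open>W\<close>, the factor 3 is exactly
    \<open>2 ^ 2 * (3/4)\<close>.\<close>
  have "{S. S \<subseteq> V \<and> S \<inter> F = {} \<and> (\<forall>t<Suc j. \<not> (x t \<in> S \<and> y t \<in> S))}
      \<subseteq> G \<union> insert (x j) ` G \<union> insert (y j) ` G" (is "?A \<subseteq> _")
  proof
    fix S
    assume S: "S \<in> ?A"
    define T where "T = S - {x j, y j}"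
    have G: "T \<in> G"
      using S by (auto simp: T_def G_def W_def)
    have "\<not> (x j \<in> S \<and> y j \<in> S)"
      using S by auto
    then have "S = T \<or> S = insert (x j) T \<or> S = insert (y j) T"
      by (auto simp: T_def)
    then show "S \<in> G \<union> insert (x j) ` G \<union> insert (y j) ` G"
      using G by auto
  qed
  then have "card ?A \<le> card (G \<union> insert (x j) ` G \<union> insert (y j) ` G)"
    using fG by (intro card_mono) auto
  also have "\<dots> \<le> card G + card G + card G"
    using card_Un_le[of "G \<union> insert (x j) ` G" "insert (y j) ` G"]
      card_Un_le[of G "insert (x j) ` G"] card_image_le[OF fG, of "insert (x j)"]
      card_image_le[OF fG, of "insert (y j)"] by linarith
  finally have "real (card ?A) \<le> 3 * real (card G)"
    by linarith
  then show ?case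
    using IH by (simp add: cV)
qed

text \<open>Every exponent occurs at most twice, so the bound is twice the geometric series with
  value 4; padding to an even number of terms gives a closed form.\<close>

lemma sum_power_half_index_le: "(\<Sum>i<k. (3/4 :: real) ^ (i div 2)) \<le> 8"
proof -
  have "(\<Sum>i<2 * k. (3/4 :: real) ^ (i div 2)) = 8 - 8 * (3/4) ^ k"
    by (induction k) auto
  moreover have "(\<Sum>i<k. (3/4 :: real) ^ (i div 2)) \<le> (\<Sum>i<2 * k. (3/4) ^ (i div 2))"
    by (intro sum_mono2) auto
  moreover have "0 \<le> 8 * (3/4 :: real) ^ k"
    by simp
  ultimately show ?thesis
    by linarith
qed

section \<open>The fringes and what they force\<close>

text \<open>The upper fringe is stored as the distances of its elements from \<open>N - 1\<close>.\<close>

definition lower_fringe :: "int set" where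
  "lower_fringe = {0, 2, 3, 7, 8, 9, 10}"

definition upper_fringe :: "int set" where
  "upper_fringe = {0, 1, 2, 5, 7, 8, 9, 10}"

definition fringed :: "int \<Rightarrow> int set \<Rightarrow> int set" where
  "fringed N S = lower_fringe \<union> S \<union> (\<lambda>u. N - 1 - u) ` upper_fringe"

lemma lower_fringe_sums:
  assumes "0 \<le> k" "k \<le> 20" "k \<noteq> 1"
  shows "\<exists>a\<in>lower_fringe. \<exists>b\<in>lower_fringe. k = a + b"
proof -
  have "k \<in> {0,2,3,4,5,6,7,8,9,10,11,12,13,14,15,16,17,18,19,20}"
    using assms by simp presburger
  then show ?thesis
    unfolding lower_fringe_def by (elim insertE) simp_all
qed

lemma upper_fringe_sums:
  assumes "0 \<le> k" "k \<le> 20"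
  shows "\<exists>a\<in>upper_fringe. \<exists>b\<in>upper_fringe. k = a + b"
proof -
  have "k \<in> {0,1,2,3,4,5,6,7,8,9,10,11,12,13,14,15,16,17,18,19,20}"
    using assms by simp presburger
  then show ?thesis
    unfolding upper_fringe_def by (elim insertE) simp_all
qed

text \<open>Since \<open>a + (N - 1 - b) = N - 1 + (a - b)\<close>, these differences supply the
  middle sums \<open>N - 11\<close> to \<open>N + 9\<close>.\<close>

lemma fringe_differences:
  assumes "-10 \<le> k" "k \<le> 10"
  shows "\<exists>a\<in>lower_fringe. \<exists>b\<in>upper_fringe. k = a - b"
proof -
  have "k \<in> {-10,-9,-8,-7,-6,-5,-4,-3,-2,-1,0,1,2,3,4,5,6,7,8,9,10}"
    using assms by simp presburger
  then show ?thesis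
    unfolding lower_fringe_def upper_fringe_def by (elim insertE) simp_all
qed

lemma fringed_subset:
  assumes "N \<ge> 22" "S \<subseteq> {11..N - 12}"
  shows "fringed N S \<subseteq> {0..N - 1}"
  using assms by (auto simp: fringed_def lower_fringe_def upper_fringe_def)

text \<open>Neither fringe meets \<open>{11..N - 12}\<close>, so intersecting with it recovers the
  middle part. Hence counting middle parts counts sets.\<close>

lemma inj_on_fringed: "inj_on (fringed N) (Pow {11..N - 12})"
proof (rule inj_onI)
  fix S T
  assume "S \<in> Pow {11..N - 12}" "T \<in> Pow {11..N - 12}" "fringed N S = fringed N T"
  moreover have "fringed N S \<inter> {11..N - 12} = S" if "S \<in> Pow {11..N - 12}" for S
    using that by (auto simp: fringed_def lower_fringe_def upper_fringe_def)
  ultimately show "S = T"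
    by metis
qed

text \<open>The fringes decide every sum outside the ranges of \<open>low\<close> and
  \<open>up\<close>; \<open>up\<close> is \<open>low\<close> reflected by
  \<open>k \<mapsto> 2 * N - 2 - k\<close>.\<close>

lemma fringed_more_sums:
  assumes N: "N \<ge> 22" and S: "S \<subseteq> {11..N - 12}"
    and low: "\<And>k. 21 \<le> k \<Longrightarrow> k \<le> N - 12 \<Longrightarrow> k \<in> fringed N S + fringed N S"
    and up: "\<And>k. 21 \<le> k \<Longrightarrow> k \<le> N - 12 \<Longrightarrow> 2 * N - 2 - k \<in> fringed N S + fringed N S"
  shows "card (diffset (fringed N S) (fringed N S)) < card (fringed N S + fringed N S)"
proof -
  let ?A = "fringed N S"
  have A: "?A \<subseteq> {0..N - 1}"
    using N S by (rule fringed_subset)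
  then have fin: "finite ?A"
    by (rule finite_subset) simp
  have lowA: "a \<in> ?A" if "a \<in> lower_fringe" for a
    using that by (simp add: fringed_def)
  have upA: "N - 1 - b \<in> ?A" if "b \<in> upper_fringe" for b
    using that by (simp add: fringed_def)
  have "{0..2 * N - 2} - {1} \<subseteq> ?A + ?A"
  proof
    fix k
    assume k: "k \<in> {0..2 * N - 2} - {1}"
    consider "k \<le> 20" | "21 \<le> k" "k \<le> N - 12" | "N - 11 \<le> k" "k \<le> N + 9"
      | "N + 10 \<le> k" "k \<le> 2 * N - 23" | "2 * N - 22 \<le> k"
      by linarith
    then show "k \<in> ?A + ?A"
    proof cases
      case 1
      then obtain a b where "a \<in> lower_fringe" "b \<in> lower_fringe" "k = a + b"
        using k lower_fringe_sums[of k] by auto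
      then show ?thesis
        using lowA by (auto intro: set_plus_intro)
    next
      case 2
      then show ?thesis
        by (rule low)
    next
      case 3
      then obtain a b where "a \<in> lower_fringe" "b \<in> upper_fringe" "k - (N - 1) = a - b"
        using fringe_differences[of "k - (N - 1)"] by auto
      moreover from this have "k = a + (N - 1 - b)"
        by simp
      ultimately show ?thesis
        using set_plus_intro[OF lowA upA, of a b] by metis
    next
      case 4
      then show ?thesis
        using up[of "2 * N - 2 - k"] by simp
    next
      case 5
      then obtain a b where "a \<in> upper_fringe" "b \<in> upper_fringe" "2 * N - 2 - k = a + b"
        using k upper_fringe_sums[of "2 * N - 2 - k"] by auto
      moreover from this have "k = (N - 1 - a) + (N - 1 - b)"
        by simp
      ultimately show ?thesis
        using set_plus_intro[OF upA upA, of a b] by metis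
    qed
  qed
  then have "card ({0..2 * N - 2} - {1}) \<le> card (?A + ?A)"
    using fin by (intro card_mono finite_set_plus)
  then have sums: "nat (2 * N - 2) \<le> card (?A + ?A)"
    using N by simp
  have missing: "a - b \<noteq> N - 7" if ab: "a \<in> ?A" "b \<in> ?A" for a b
  proof
    assume eq: "a - b = N - 7"
    have "a \<le> N - 1" "0 \<le> b"
      using A ab by auto
    then have "b \<le> 6" "N - 7 \<le> a"
      using eq by auto
    \<comment> \<open>As \<open>N \<ge> 22\<close>, both elements lie in the fringes. The values 0,
      2, 3 of \<open>b\<close> would need \<open>a\<close> at distance 6, 4, 3 from
      \<open>N - 1\<close>, exactly the distances up to 10 that \<open>upper_fringe\<close>
      omits.\<close>
    then have "b \<in> {0, 2, 3}" "a \<in> {N - 1, N - 2, N - 3, N - 6}"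
      using ab N S by (auto simp: fringed_def lower_fringe_def upper_fringe_def)
    then show False
      using eq by auto
  qed
  have "diffset ?A ?A \<subseteq> {- (N - 1)..N - 1} - {N - 7, - (N - 7)}"
  proof
    fix d
    assume "d \<in> diffset ?A ?A"
    then obtain a b where "a \<in> ?A" "b \<in> ?A" "d = a - b"
      by (auto simp: diffset_def)
    moreover from this have "a \<in> {0..N - 1}" "b \<in> {0..N - 1}"
      using A by auto
    ultimately show "d \<in> {- (N - 1)..N - 1} - {N - 7, - (N - 7)}"
      using missing[of a b] missing[of b a] by auto
  qed
  then have "card (diffset ?A ?A) \<le> card ({- (N - 1)..N - 1} - {N - 7, - (N - 7)})"
    by (intro card_mono) auto
  also have "\<dots> = nat (2 * N - 1) - 2"
    using N by (subst card_Diff_subset) auto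
  finally show ?thesis
    using sums N by linarith
qed

section \<open>Middle parts that miss a given sum\<close>

text \<open>If \<open>k\<close> is not a sum, then \<open>k - a\<close> is absent for each of the 7
  elements \<open>a\<close> of \<open>lower_fringe\<close>, and no two middle elements add up to
  \<open>k\<close>.\<close>

lemma card_fringed_missing_low_sum:
  assumes i: "21 + int i \<le> N - 12"
  shows "real (card {S. S \<subseteq> {11..N - 12} \<and> 21 + int i \<notin> fringed N S + fringed N S})
           \<le> 2 ^ nat (N - 22) * (1/2) ^ 7 * (3/4) ^ (i div 2)"
proof -
  let ?V = "{11..N - 12}"
  define k where "k = 21 + int i"
  define F where "F = (\<lambda>a. k - a) ` lower_fringe"
  \<comment> \<open>The \<open>i\<close> points of \<open>{11..k - 11}\<close> lie below
    \<open>F\<close> and are paired from the outside in; for odd \<open>i\<close> the midpoint is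
    left out.\<close>
  define x where "x = (\<lambda>t. 11 + int t)"
  define y where "y = (\<lambda>t. k - x t)"
  have bad: "S \<inter> F = {}" "\<not> (x t \<in> S \<and> y t \<in> S)"
    if "k \<notin> fringed N S + fringed N S" for S t
  proof -
    have no: "\<not> (a \<in> fringed N S \<and> k - a \<in> fringed N S)" for a
      using that set_plus_intro[of a "fringed N S" "k - a" "fringed N S"] by auto
    then show "\<not> (x t \<in> S \<and> y t \<in> S)"
      by (auto simp: fringed_def y_def)
    show "S \<inter> F = {}"
      using no by (auto simp: fringed_def F_def)
  qed
  have "card F = 7"
    unfolding F_def by (subst card_image) (auto simp: inj_on_def lower_fringe_def)
  have "real (card {S. S \<subseteq> ?V \<and> k \<notin> fringed N S + fringed N S})
      \<le> real (card {S. S \<subseteq> ?V \<and> S \<inter> F = {} \<and> (\<forall>t<i div 2. \<not> (x t \<in> S \<and> y t \<in> S))})"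
    unfolding of_nat_le_iff by (rule card_mono) (use bad in auto)
  also have "\<dots> \<le> 2 ^ card ?V * (1/2) ^ card F * (3/4) ^ (i div 2)"
  proof (rule card_subsets_avoiding_pairs_le)
    show "F \<subseteq> ?V"
      using i by (auto simp: F_def lower_fringe_def k_def)
    show "x t \<in> ?V - F" "y t \<in> ?V - F" if "t < i div 2" for t
      using that i by (auto simp: x_def y_def F_def lower_fringe_def k_def)
    show "x s \<noteq> y t" if "s < i div 2" "t < i div 2" for s t
      using that by (auto simp: x_def y_def k_def)
  qed (auto simp: inj_on_def x_def y_def)
  finally show ?thesis
    by (simp add: \<open>card F = 7\<close> k_def)
qed

text \<open>The previous argument reflected by \<open>z \<mapsto> N - 1 - z\<close>: the 8 elements
  of \<open>upper_fringe\<close> force absences, and the pairs start from \<open>N - 12\<close>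
  downwards.\<close>

lemma card_fringed_missing_high_sum:
  assumes i: "21 + int i \<le> N - 12"
  shows "real (card {S. S \<subseteq> {11..N - 12} \<and> 2 * N - 2 - (21 + int i) \<notin> fringed N S + fringed N S})
           \<le> 2 ^ nat (N - 22) * (1/2) ^ 8 * (3/4) ^ (i div 2)"
proof -
  let ?V = "{11..N - 12}"
  define k where "k = 2 * N - 2 - (21 + int i)"
  define F where "F = (\<lambda>u. k - (N - 1 - u)) ` upper_fringe"
  define x where "x = (\<lambda>t. N - 12 - int t)"
  define y where "y = (\<lambda>t. k - x t)"
  have bad: "S \<inter> F = {}" "\<not> (x t \<in> S \<and> y t \<in> S)"
    if "k \<notin> fringed N S + fringed N S" for S t
  proof -
    have no: "\<not> (a \<in> fringed N S \<and> k - a \<in> fringed N S)" for a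
      using that set_plus_intro[of a "fringed N S" "k - a" "fringed N S"] by auto
    then show "\<not> (x t \<in> S \<and> y t \<in> S)"
      by (auto simp: fringed_def y_def)
    show "S \<inter> F = {}"
      using no by (auto simp: fringed_def F_def)
  qed
  have "card F = 8"
    unfolding F_def by (subst card_image) (auto simp: inj_on_def upper_fringe_def)
  have "real (card {S. S \<subseteq> ?V \<and> k \<notin> fringed N S + fringed N S})
      \<le> real (card {S. S \<subseteq> ?V \<and> S \<inter> F = {} \<and> (\<forall>t<i div 2. \<not> (x t \<in> S \<and> y t \<in> S))})"
    unfolding of_nat_le_iff by (rule card_mono) (use bad in auto)
  also have "\<dots> \<le> 2 ^ card ?V * (1/2) ^ card F * (3/4) ^ (i div 2)"
  proof (rule card_subsets_avoiding_pairs_le)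
    show "F \<subseteq> ?V"
      using i by (auto simp: F_def upper_fringe_def k_def)
    show "x t \<in> ?V - F" "y t \<in> ?V - F" if "t < i div 2" for t
      using that i by (auto simp: x_def y_def F_def upper_fringe_def k_def)
    show "x s \<noteq> y t" if "s < i div 2" "t < i div 2" for s t
      using that by (auto simp: x_def y_def k_def)
  qed (auto simp: inj_on_def x_def y_def)
  finally show ?thesis
    by (simp add: \<open>card F = 8\<close> k_def)
qed

section \<open>Union bound over the undecided sums\<close>

lemma card_more_sums_ge:
  assumes N: "N \<ge> 22"
  shows "real (card {S. S \<subseteq> {0..N - 1} \<and> card (S + S) > card (diffset S S)})
           \<ge> 29/32 * 2 ^ nat (N - 22)"
proof -
  let ?V = "{11..N - 12}"
  define m where "m = nat (N - 22)"
  \<comment> \<open>The number of \<open>k\<close> with \<open>21 \<le> k \<le> N - 12\<close>; it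
    is 0 for \<open>N \<le> 32\<close>, when no sum is left undecided.\<close>
  define K where "K = nat (N - 32)"
  define low where "low = (\<lambda>i. {S. S \<subseteq> ?V \<and> 21 + int i \<notin> fringed N S + fringed N S})"
  define high where
    "high = (\<lambda>i. {S. S \<subseteq> ?V \<and> 2 * N - 2 - (21 + int i) \<notin> fringed N S + fringed N S})"
  define Bad where "Bad = (\<Union>i<K. low i \<union> high i)"
  have BadV: "Bad \<subseteq> Pow ?V"
    by (auto simp: Bad_def low_def high_def)
  have "real (card Bad) \<le> (\<Sum>i<K. real (card (low i \<union> high i)))"
    unfolding Bad_def of_nat_sum[symmetric] of_nat_le_iff by (rule card_UN_le) simp
  \<comment> \<open>Here \<open>3/256\<close> is \<open>2^(-7) + 2^(-8)\<close>, the low and high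
    contributions together.\<close>
  also have "\<dots> \<le> (\<Sum>i<K. 2 ^ m * (3/256) * (3/4) ^ (i div 2))"
  proof (rule sum_mono)
    fix i
    assume "i \<in> {..<K}"
    then have i: "21 + int i \<le> N - 12"
      by (auto simp: K_def)
    have "real (card (low i \<union> high i)) \<le> real (card (low i)) + real (card (high i))"
      using card_Un_le[of "low i" "high i"] by linarith
    also have "\<dots> \<le> 2 ^ m * (1/2) ^ 7 * (3/4) ^ (i div 2) + 2 ^ m * (1/2) ^ 8 * (3/4) ^ (i div 2)"
      using card_fringed_missing_low_sum[OF i] card_fringed_missing_high_sum[OF i]
      unfolding low_def high_def m_def by (rule add_mono)
    also have "\<dots> = 2 ^ m * (3/256) * (3/4) ^ (i div 2)"
      by (simp add: power_one_over)
    finally show "real (card (low i \<union> high i)) \<le> 2 ^ m * (3/256) * (3/4) ^ (i div 2)" .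
  qed
  also have "\<dots> = 2 ^ m * (3/256) * (\<Sum>i<K. (3/4) ^ (i div 2))"
    by (simp add: sum_distrib_left)
  also have "\<dots> \<le> 2 ^ m * (3/256) * 8"
    by (intro mult_left_mono sum_power_half_index_le) auto
  finally have bad: "real (card Bad) \<le> 3/32 * 2 ^ m"
    by simp
  have "card (Pow ?V) = 2 ^ m"
    by (simp add: card_Pow m_def)
  moreover have "card (Pow ?V - Bad) = card (Pow ?V) - card Bad"
    using BadV by (intro card_Diff_subset) (auto intro: finite_subset)
  moreover have "card Bad \<le> card (Pow ?V)"
    using BadV by (intro card_mono) auto
  ultimately have "real (card (Pow ?V - Bad)) \<ge> 29/32 * 2 ^ m"
    using bad by (simp add: of_nat_diff)
  also have "card (Pow ?V - Bad) = card (fringed N ` (Pow ?V - Bad))"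
    by (rule card_image[symmetric], rule inj_on_subset[OF inj_on_fringed]) auto
  also have "\<dots> \<le> card {S. S \<subseteq> {0..N - 1} \<and> card (S + S) > card (diffset S S)}"
  proof (rule card_mono)
    show "fringed N ` (Pow ?V - Bad) \<subseteq> {S. S \<subseteq> {0..N - 1} \<and> card (S + S) > card (diffset S S)}"
    proof clarify
      fix S
      assume S: "S \<subseteq> ?V" "S \<notin> Bad"
      have "k \<in> fringed N S + fringed N S \<and> 2 * N - 2 - k \<in> fringed N S + fringed N S"
        if "21 \<le> k" "k \<le> N - 12" for k
      proof -
        have "nat (k - 21) < K" and k: "21 + int (nat (k - 21)) = k"
          using that by (auto simp: K_def)
        then have "S \<notin> low (nat (k - 21)) \<union> high (nat (k - 21))"
          using S(2) by (auto simp: Bad_def)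
        then show ?thesis
          unfolding low_def high_def k using S(1) by blast
      qed
      then show "fringed N S \<subseteq> {0..N - 1} \<and>
          card (diffset (fringed N S) (fringed N S)) < card (fringed N S + fringed N S)"
        using fringed_more_sums[OF N S(1)] fringed_subset[OF N S(1)] by blast
    qed
  qed simp
  finally show ?thesis
    by (simp add: m_def)
qed

section \<open>Small \<open>n\<close> and the final bound\<close>

lemma conway_set_more_sums:
  defines "C \<equiv> {0, 2, 3, 4, 7, 11, 12, 14} :: int set"
  shows "card (diffset C C) < card (C + C)"
proof -
  have "diffset C C = (\<Union>a\<in>C. \<Union>b\<in>C. {a - b})"
    by (auto simp: diffset_def)
  also have "\<dots> = {-14,-12,-11,-10,-9,-8,-7,-5,-4,-3,-2,-1,0,1,2,3,4,5,7,8,9,10,11,12,14}"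
    by (auto simp: C_def)
  finally have "card (diffset C C) = 25"
    by simp
  moreover have "C + C = (\<Union>a\<in>C. \<Union>b\<in>C. {a + b})"
    by (auto simp: set_plus_def)
  then have "C + C = {0,2,3,4,5,6,7,8,9,10,11,12,13,14,15,16,17,18,19,21,22,23,24,25,26,28}"
    by (auto simp: C_def)
  then have "card (C + C) = 26"
    by simp
  ultimately show ?thesis
    by simp
qed

theorem theorem14:
  fixes n :: nat
  assumes "n \<ge> 15"
  shows "real (card {S. S \<subseteq> {0..int n - 1} \<and> card (S + S) > card (diffset S S)})
           \<ge> (2 * 10 powi (-7)) * 2 ^ n"
proof (cases "n \<ge> 22")
  case True
  then obtain m where n: "n = m + 22"
    using le_Suc_ex by (metis add.commute)
  have "(2 * 10 powi (-7)) * 2 ^ n \<le> 29/32 * (2::real) ^ m"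
    by (simp add: n power_add power_int_minus divide_simps)
  also have "m = nat (int n - 22)"
    by (simp add: n)
  finally show ?thesis
    using card_more_sums_ge[of "int n"] True by linarith
next
  case False
  let ?M = "{S. S \<subseteq> {0..int n - 1} \<and> card (S + S) > card (diffset S S)}"
  \<comment> \<open>The largest element is 14, so the set fits because
    \<open>n \<ge> 15\<close>.\<close>
  have "{0, 2, 3, 4, 7, 11, 12, 14} \<in> ?M"
    using assms conway_set_more_sums by auto
  then have "?M \<noteq> {}"
    by blast
  moreover have "finite ?M"
    by simp
  ultimately have "card ?M > 0"
    by (simp only: card_gt_0_iff simp_thms)
  moreover have "(2::real) ^ n \<le> 2 ^ 21"
    using False by (intro power_increasing) auto
  then have "(2 * 10 powi (-7)) * (2::real) ^ n \<le> 1"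
    by (simp add: power_int_minus divide_simps)
  ultimately show ?thesis
    by linarith
qed

end
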